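(* Let $X=\{0,1\}$ and let $\boldsymbol{\xi}=(\xi_n)_{n=0}^{\infty}$ be a time-homogeneous Markov chain with state space $X$, with some initial distribution $P(\xi_0=x)$, $x\in X$, and with one-step transition probabilities $\pi(x,y)=P(\xi_n=y\mid \xi_{n-1}=x)$ ($n\ge 1$, $x,y\in X$). Assume that $$\pi(x,y)\neq 0 \ \text{ for all } x,y\in X,\qquad \pi(0,0)\neq \pi(1,1),\qquad \pi(0,0)+\pi(1,1)\neq 1 .$$ Define the higher-order absolute differences by $\xi_n^{(0)}=\xi_n$ and $\xi_n^{(k)}=|\xi_{n+1}^{(k-1)}-\xi_n^{(k-1)}|$ for $k\ge 1$, $n\ge 0$, and put $\boldsymbol{\xi}^{(k)}=(\xi_n^{(k)})_{n=0}^{\infty}$. Then the equi-distributed random binary sequence is a $\mathfrak{T}$-limit process for the series of random binary sequences $\boldsymbol{\xi}^{(k)}$, $k\ge 0$. More precisely, for every $x\in X$ and every $n\ge 0$ there exist integers $s_p$ ($p\ge 1$) with $0\le s_p\le p$, $s_p\to\infty$ as $p\to\infty$, and $\sum_{p=1}^{\infty}s_p2^{-s_p}=\infty$, such that the set $$E=\bigcup_{p=1}^{\infty}\{k\in\mathbb{N}:\ 2^p\le k<2^{p+1},\ \nu(k)\ge s_p\}$$ is a $\mathfrak{T}$-set and $$\lim_{\substack{k\to\infty\\ k\in E}}P(\xi_n^{(k)}=x)=\frac12 .$$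
   Context: $\mathbb{N}=\{0,1,2,\dots\}$. The sequence $\boldsymbol{\xi}$ is a time-homogeneous Markov chain with transition function $\pi$ on $X\times X$ if for all $n\ge1$ and all $x,y,x_1,\dots,x_{n-1}\in X$ one has $P(\xi_n=y\mid\xi_{n-1}=x,\xi_{n-2}=x_1,\dots,\xi_0=x_{n-1})=P(\xi_n=y\mid\xi_{n-1}=x)=\pi(x,y)$, whenever the conditioning events have positive probability; $\pi$ is a stochastic matrix. For $k\ge1$ with binary expansion $k=\sum_{i=0}^{p}\varepsilon_i2^i$, $\varepsilon_i\in\{0,1\}$, $\varepsilon_p=1$, let $\nu(k)$ be the number of trailing ones in this expansion, i.e. the maximal $m$ with $0\le m\le p+1$ such that $\varepsilon_i=1$ for all $0\le i<m$ (so $\nu(k)=0$ for even $k$); put $\nu(0)=0$. For $e\subseteq\mathbb{N}$ define the discrete capacity $\mathcal{C}(e)=\sum_{k\in e}\nu(k)\in[0,\infty]$. Let $K_p=\{k\in\mathbb{N}:2^p\le k<2^{p+1}\}$. A set $e\subseteq\mathbb{N}$ is thin (an $\mathfrak{F}$-set) if $\sum_{p=1}^{\infty}2^{-p}\mathcal{C}(e\cap K_p)<\infty$; otherwise it is thick (a $\mathfrak{T}$-set). A number $a$ is a $\mathfrak{T}$-limit point of a numerical sequence $(a_k)_{k\ge0}$ if there is a $\mathfrak{T}$-set $E\subseteq\mathbb{N}$ such that $\lim_{k\to\infty,\,k\in E}a_k=a$. A random binary sequence $(\eta_n)_{n\ge0}$ is a $\mathfrak{T}$-limit process for a series of random binary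 sequences $(\xi_{n,k})_{n\ge0}$, $k\ge0$, if for every $x\in X$ and $n\ge0$ the number $P(\eta_n=x)$ is a $\mathfrak{T}$-limit point of the sequence $P(\xi_{n,k}=x)$, $k\ge0$. The equi-distributed random binary sequence is a random binary sequence $(\eta_n)_{n\ge0}$ with $P(\eta_n=0)=P(\eta_n=1)=\frac12$ for all $n\ge 0$. *)

theory Defs
  imports "HOL-Probability.Probability"
begin

definition stochastic_matrix :: "'s set \<Rightarrow> ('s \<Rightarrow> 's \<Rightarrow> real) \<Rightarrow> bool" where
  "stochastic_matrix X \<pi> \<longleftrightarrow>
     (\<forall>x\<in>X. (\<forall>y\<in>X. 0 \<le> \<pi> x y) \<and> (\<pi> x has_sum 1) X)"

(* The history is h 0, ..., h n in chronological order.  Since division by 0 yields 0,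
   the positivity of the conditioning events has to be required explicitly. *)
definition markov_chain ::
    "'a measure \<Rightarrow> 's set \<Rightarrow> ('s \<Rightarrow> 's \<Rightarrow> real) \<Rightarrow> (nat \<Rightarrow> 'a \<Rightarrow> 's) \<Rightarrow> bool" where
  "markov_chain M X \<pi> \<xi> \<longleftrightarrow>
     prob_space M \<and> countable X \<and> stochastic_matrix X \<pi> \<and>
     (\<forall>n. \<xi> n \<in> measurable M (count_space X)) \<and>
     (\<forall>n h. \<forall>y\<in>X. (\<forall>i\<le>n. h i \<in> X) \<longrightarrow> \<P>(\<omega> in M. \<forall>i\<le>n. \<xi> i \<omega> = h i) > 0 \<longrightarrow>
        \<P>(\<omega> in M. \<xi> (Suc n) \<omega> = y \<bar> \<forall>i\<le>n. \<xi> i \<omega> = h i)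
          = \<P>(\<omega> in M. \<xi> (Suc n) \<omega> = y \<bar> \<xi> n \<omega> = h n)) \<and>
     (\<forall>n. \<forall>x\<in>X. \<forall>y\<in>X. \<P>(\<omega> in M. \<xi> n \<omega> = x) > 0 \<longrightarrow>
        \<P>(\<omega> in M. \<xi> (Suc n) \<omega> = y \<bar> \<xi> n \<omega> = x) = \<pi> x y)"

(* The set is finite, because almost all binary digits of k vanish; it is {0} for k = 0. *)
definition trailing_ones :: "nat \<Rightarrow> nat" where
  "trailing_ones k = Max {m. \<forall>i<m. bit k i}"

definition discrete_capacity :: "nat set \<Rightarrow> ennreal" where
  "discrete_capacity e = (\<Sum>\<^sub>\<infinity>k\<in>e. of_nat (trailing_ones k))"

definition dyadic_block :: "nat \<Rightarrow> nat set" where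
  "dyadic_block p = {2 ^ p..<2 ^ Suc p}"

definition thin_set :: "nat set \<Rightarrow> bool" where
  "thin_set e \<longleftrightarrow> (\<Sum>\<^sub>\<infinity>p\<in>{1..}. discrete_capacity (e \<inter> dyadic_block p) / 2 ^ p) < \<infinity>"

abbreviation thick_set :: "nat set \<Rightarrow> bool" where
  "thick_set e \<equiv> \<not> thin_set e"

definition tendsto_along :: "nat set \<Rightarrow> (nat \<Rightarrow> real) \<Rightarrow> real \<Rightarrow> bool" where
  "tendsto_along E a l \<longleftrightarrow> (a \<longlongrightarrow> l) (inf sequentially (principal E))"

definition thick_limit_point :: "(nat \<Rightarrow> real) \<Rightarrow> real \<Rightarrow> bool" where
  "thick_limit_point a l \<longleftrightarrow> (\<exists>E. thick_set E \<and> tendsto_along E a l)"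

definition random_binary_sequence :: "'a measure \<Rightarrow> (nat \<Rightarrow> 'a \<Rightarrow> int) \<Rightarrow> bool" where
  "random_binary_sequence M \<eta> \<longleftrightarrow>
     prob_space M \<and> (\<forall>n. \<eta> n \<in> measurable M (count_space {0, 1}))"

(* Only one-dimensional marginals enter, so the limit process may live on another space. *)
definition thick_limit_process ::
    "'b measure \<Rightarrow> (nat \<Rightarrow> 'b \<Rightarrow> int) \<Rightarrow> 'a measure \<Rightarrow> (nat \<Rightarrow> nat \<Rightarrow> 'a \<Rightarrow> int) \<Rightarrow> bool" where
  "thick_limit_process N \<eta> M \<zeta> \<longleftrightarrow>
     random_binary_sequence N \<eta> \<and> (\<forall>k. random_binary_sequence M (\<zeta> k)) \<and>
     (\<forall>x\<in>{0, 1}. \<forall>n. thick_limit_point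
        (\<lambda>k. \<P>(\<omega> in M. \<zeta> k n \<omega> = x)) \<P>(\<omega> in N. \<eta> n \<omega> = x))"

definition equidistributed_binary_sequence :: "'b measure \<Rightarrow> (nat \<Rightarrow> 'b \<Rightarrow> int) \<Rightarrow> bool" where
  "equidistributed_binary_sequence N \<eta> \<longleftrightarrow>
     random_binary_sequence N \<eta> \<and>
     (\<forall>n. \<P>(\<omega> in N. \<eta> n \<omega> = 0) = 1 / 2 \<and> \<P>(\<omega> in N. \<eta> n \<omega> = 1) = 1 / 2)"

primrec abs_differences :: "(nat \<Rightarrow> 'a \<Rightarrow> int) \<Rightarrow> nat \<Rightarrow> nat \<Rightarrow> 'a \<Rightarrow> int" where
  "abs_differences \<xi> 0 = \<xi>"
| "abs_differences \<xi> (Suc k) =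
     (\<lambda>n \<omega>. \<bar>abs_differences \<xi> k (Suc n) \<omega> - abs_differences \<xi> k n \<omega>\<bar>)"

end

theory Submission
  imports Defs "HOL-Library.Discrete_Functions"
begin

text \<open>
  Modulo \<open>2\<close>, \<open>\<xi>\<^sub>n\<^sup>(\<^sup>k\<^sup>)\<close> is the sum of the \<open>\<xi>\<^sub>j\<close> over \<open>j \<in> S\<close>, where \<open>S\<close> consists of the \<open>n + i\<close> with
  odd \<open>k choose i\<close>. If \<open>k\<close> ends in \<open>m\<close> ones, then \<open>2\<^sup>m\<close> divides \<open>k + 1\<close>, and Pascal's rule shows that
  \<open>S\<close> contains the run \<open>n, ..., n + 2\<^sup>m - 1\<close>. The bias \<open>E (-1)^\<xi>\<^sub>n\<^sup>(\<^sup>k\<^sup>)\<close> is a product of the matrices \<open>P\<close> and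
  \<open>P D\<close>, where \<open>P\<close> is the transition matrix and \<open>D = diag (1, -1)\<close>, with a factor \<open>P D\<close> for each index
  in \<open>S\<close>. Both have maximal absolute row sum at most \<open>1\<close>, whereas for \<open>(P D)\<^sup>2\<close> it is some
  \<open>\<rho> < 1\<close> because cancellation occurs in the diagonal entries. So the bias is at most \<open>\<rho>\<close> to the power
  \<open>\<lfloor>m / 2\<rfloor>\<close>, whatever \<open>n\<close> is. The choice \<open>s\<^sub>p = \<lfloor>log\<^sub>2 p\<rfloor>\<close> makes the capacity series dominate the harmonic series.
\<close>

subsection \<open>Trailing ones and binomial coefficients\<close>

text \<open>The set under \<open>Max\<close> is downward closed, so comparison with its maximum
  amounts to membership. It is bounded by \<open>k\<close>: a larger member would force
  \<open>bit k k\<close>, although \<open>k < 2 ^ k\<close>.\<close>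

lemma le_trailing_ones_iff:
  assumes "k > 0"
  shows "s \<le> trailing_ones k \<longleftrightarrow> (\<forall>i<s. bit k i)"
proof -
  let ?A = "{m. \<forall>i<m. bit k i}"
  have "m \<le> k" if "\<forall>i<m. bit k i" for m
  proof (rule ccontr)
    assume "\<not> m \<le> k"
    with that have "bit k k" by simp
    moreover have "k < 2 ^ k" by simp
    ultimately show False by (simp add: bit_iff_odd)
  qed
  then have fin: "finite ?A"
    by (intro finite_subset[of ?A "{..k}"]) auto
  have "0 \<in> ?A" by simp
  then have "trailing_ones k \<in> ?A"
    unfolding trailing_ones_def using Max_in[OF fin] by blast
  moreover have "m \<le> trailing_ones k" if "m \<in> ?A" for m
    unfolding trailing_ones_def using Max_ge[OF fin that] .
  ultimately show ?thesis by auto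
qed

text \<open>The residue form serves twice: for divisibility of \<open>Suc k\<close> and for counting
  in a dyadic block.\<close>

lemma le_trailing_ones_iff_mod:
  assumes "k > 0"
  shows "s \<le> trailing_ones k \<longleftrightarrow> k mod 2 ^ s = 2 ^ s - 1"
proof -
  have "(\<forall>i<s. bit k i) \<longleftrightarrow> take_bit s k = mask s"
    by (auto simp: bit_eq_iff bit_take_bit_iff bit_mask_iff)
  then show ?thesis
    using le_trailing_ones_iff[OF assms] by (simp add: take_bit_eq_mod mask_eq_exp_minus_1)
qed

text \<open>By Pascal's rule, oddness passes from \<open>i\<close> to \<open>Suc i\<close> once
  \<open>Suc k choose Suc i\<close> is even. The absorption identity shows that
  \<open>2 ^ trailing_ones k\<close> divides \<open>Suc i\<close> times this coefficient; were the
  coefficient odd, the power would divide the smaller positive number \<open>Suc i\<close>.\<close>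

lemma odd_binomial_of_trailing_ones:
  assumes "k > 0" "i < 2 ^ trailing_ones k"
  shows "odd (k choose i)"
  using assms(2)
proof (induction i)
  case (Suc i)
  let ?m = "trailing_ones k"
  have "k mod 2 ^ ?m = 2 ^ ?m - 1"
    using le_trailing_ones_iff_mod[OF assms(1)] by blast
  then have "2 ^ ?m dvd Suc k"
    by (metis Suc_pred' dvd_eq_mod_eq_0 mod_Suc zero_less_numeral zero_less_power)
  then have dvd: "2 ^ ?m dvd Suc i * (Suc k choose Suc i)"
    by (metis Suc_times_binomial dvd_mult2)
  have "even (Suc k choose Suc i)"
  proof (rule ccontr)
    assume "odd (Suc k choose Suc i)"
    then have "coprime (2 ^ ?m) (Suc k choose Suc i)"
      by (simp del: binomial_Suc_Suc)
    with dvd have "2 ^ ?m dvd Suc i"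
      by (simp only: coprime_dvd_mult_left_iff)
    with Suc.prems show False by (auto dest: dvd_imp_le)
  qed
  with Suc show ?case by simp
qed simp

text \<open>The leading bit \<open>p\<close> and the lowest \<open>s\<close> bits are prescribed;
  the \<open>p - s\<close> bits in between are free and are encoded by \<open>j\<close>.\<close>

lemma card_dyadic_block_trailing_ones:
  assumes "s \<le> p"
  shows "card {k \<in> dyadic_block p. s \<le> trailing_ones k} \<ge> 2 ^ (p - s)"
proof -
  let ?f = "\<lambda>j. 2 ^ p + 2 ^ s * j + (2 ^ s - 1) :: nat"
  have "?f ` {..<2 ^ (p - s)} \<subseteq> {k \<in> dyadic_block p. s \<le> trailing_ones k}"
  proof safe
    fix j :: nat assume j: "j < 2 ^ (p - s)"
    have p: "(2::nat) ^ p = 2 ^ s * 2 ^ (p - s)"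
      using assms by (simp flip: power_add)
    have "2 ^ s * (j + 1) \<le> 2 ^ s * (2 ^ (p - s) :: nat)"
      using j by (intro mult_le_mono2) simp
    then have *: "2 ^ s * j + 2 ^ s \<le> (2 ^ p :: nat)"
      using p by (simp add: algebra_simps)
    have "(0::nat) < 2 ^ s" by simp
    with * have "2 ^ s * j + (2 ^ s - 1) < (2 ^ p :: nat)" by linarith
    then show "?f j \<in> dyadic_block p"
      unfolding dyadic_block_def atLeastLessThan_iff power_Suc by linarith
    have "?f j = 2 ^ s * (2 ^ (p - s) + j) + (2 ^ s - 1)"
      using p by (simp add: algebra_simps)
    then have "?f j mod 2 ^ s = 2 ^ s - 1"
      by (simp only: mod_mult_self4) simp
    moreover have "?f j > 0" by (intro add_pos_nonneg) simp_all
    ultimately show "s \<le> trailing_ones (?f j)"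
      by (simp only: le_trailing_ones_iff_mod)
  qed
  moreover have "inj_on ?f {..<2 ^ (p - s)}"
    by (intro inj_onI) (simp only: add_right_cancel add_left_cancel mult_cancel1, simp)
  moreover have "finite {k \<in> dyadic_block p. s \<le> trailing_ones k}"
    by (simp add: dyadic_block_def)
  ultimately show ?thesis
    by (metis (no_types, lifting) card_image card_lessThan card_mono)
qed

subsection \<open>Thick sets\<close>

text \<open>A finite value would bound the partial sums of the harmonic series. The comparison
  starts at 2 because it fails at 1 for the intended terms, as
  \<open>floor_log 1 = 0\<close>.\<close>

lemma infsum_ge_harmonic_eq_top:
  fixes f :: "nat \<Rightarrow> ennreal"
  assumes "\<And>p. p \<ge> 2 \<Longrightarrow> f p \<ge> ennreal (1 / real p)"
  shows "(\<Sum>\<^sub>\<infinity>p\<in>{1..}. f p) = \<infinity>"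
proof (rule ccontr)
  assume "\<not> ?thesis"
  then obtain B where B: "(\<Sum>\<^sub>\<infinity>p\<in>{1..}. f p) = ennreal B" "B \<ge> 0"
    by (cases "\<Sum>\<^sub>\<infinity>p\<in>{1..}. f p") auto
  have "(\<Sum>p<n. norm (1 / real (p + 2))) \<le> B" for n
  proof -
    have "ennreal (\<Sum>p<n. 1 / real (p + 2)) = (\<Sum>p<n. ennreal (1 / real (p + 2)))"
      by (subst sum_ennreal) auto
    also have "\<dots> \<le> (\<Sum>p<n. f (p + 2))" by (intro sum_mono assms) simp
    also have "\<dots> = sum f ((\<lambda>p. p + 2) ` {..<n})" by (subst sum.reindex) (auto simp: inj_on_def)
    also have "\<dots> \<le> (\<Sum>\<^sub>\<infinity>p\<in>{1..}. f p)"
      by (subst infsum_finite[symmetric], simp)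
        (rule infsum_mono_neutral, auto intro!: nonneg_summable_on_complete)
    finally show ?thesis using B by simp
  qed
  then have "summable (\<lambda>p. 1 / real (p + 2))"
    by (intro summableI_nonneg_bounded[of _ B]) auto
  then have "summable (\<lambda>p. 1 / real p)"
    by (subst (asm) summable_iff_shift)
  then show False
    using not_summable_harmonic[where 'a = real] by (simp add: inverse_eq_divide)
qed

lemma inverse_le_floor_log_quotient:
  assumes "p \<ge> 2"
  shows "1 / real p \<le> real (floor_log p) / 2 ^ floor_log p"
proof -
  have le: "2 ^ floor_log p \<le> p" using assms by (intro floor_log_exp2_le) auto
  have "floor_log p \<ge> 1" using floor_log_rec[OF assms] by linarith
  moreover have "(2::real) ^ floor_log p \<le> real p"
    using le by (metis of_nat_le_iff of_nat_numeral of_nat_power)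
  ultimately show ?thesis using assms by (intro frac_le) auto
qed

lemma floor_log_le_self: "floor_log p \<le> p"
proof (cases "p = 0")
  case False
  have "floor_log p < 2 ^ floor_log p" by simp
  also have "\<dots> \<le> p" using False by (intro floor_log_exp2_le) auto
  finally show ?thesis by simp
qed simp

lemma filterlim_floor_log: "filterlim floor_log at_top at_top"
  unfolding filterlim_at_top
proof
  fix Z :: nat
  show "\<forall>\<^sub>F p in at_top. Z \<le> floor_log p"
    using eventually_ge_at_top[of "2 ^ Z"]
    by eventually_elim (metis floor_log_power floor_log_le_iff)
qed

text \<open>At least \<open>2 ^ (p - s)\<close> elements of weight at least \<open>s\<close> each
  lie in the block, and \<open>s * 2 ^ (p - s) / 2 ^ p\<close> is \<open>s / 2 ^ s\<close>.\<close>

lemma discrete_capacity_dyadic_block_ge: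
  assumes "s \<le> p" "{k \<in> dyadic_block p. s \<le> trailing_ones k} \<subseteq> e"
  shows "discrete_capacity (e \<inter> dyadic_block p) / 2 ^ p \<ge> ennreal (real s / 2 ^ s)"
proof -
  let ?A = "{k \<in> dyadic_block p. s \<le> trailing_ones k}"
  have fin: "finite (dyadic_block p)" by (simp add: dyadic_block_def)
  have "(of_nat (s * 2 ^ (p - s)) :: ennreal) \<le> of_nat (s * card ?A)"
    using card_dyadic_block_trailing_ones[OF assms(1)] by (intro of_nat_mono) simp
  also have "\<dots> = (\<Sum>k\<in>?A. of_nat s)" by (simp add: mult.commute)
  also have "\<dots> \<le> (\<Sum>k\<in>?A. of_nat (trailing_ones k))" by (intro sum_mono) auto
  also have "\<dots> \<le> (\<Sum>k\<in>e \<inter> dyadic_block p. of_nat (trailing_ones k))"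
    using fin assms(2) by (intro sum_mono2) auto
  also have "\<dots> = discrete_capacity (e \<inter> dyadic_block p)"
    using fin by (simp add: discrete_capacity_def)
  finally have "of_nat (s * 2 ^ (p - s)) / 2 ^ p \<le> discrete_capacity (e \<inter> dyadic_block p) / 2 ^ p"
    by (rule divide_right_mono_ennreal)
  moreover have "(of_nat (s * 2 ^ (p - s)) / 2 ^ p :: ennreal) = ennreal (real s / 2 ^ s)"
  proof -
    have "(of_nat (s * 2 ^ (p - s)) / 2 ^ p :: ennreal)
        = ennreal (real (s * 2 ^ (p - s))) / ennreal (2 ^ p)"
      by (metis ennreal_numeral ennreal_of_nat_eq_real_of_nat ennreal_power zero_le_numeral)
    also have "\<dots> = ennreal (real (s * 2 ^ (p - s)) / 2 ^ p)"
      by (rule divide_ennreal) auto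
    also have "real (s * 2 ^ (p - s)) / 2 ^ p = real s / 2 ^ s"
    proof -
      have "(2::real) ^ p = 2 ^ s * 2 ^ (p - s)" using assms(1) by (simp flip: power_add)
      then show ?thesis by simp
    qed
    finally show ?thesis .
  qed
  ultimately show ?thesis by simp
qed

text \<open>Large elements of the set lie in late blocks, where the threshold \<open>s p\<close> is
  large. So \<open>trailing_ones\<close> tends to infinity along the set and drives the error bound
  \<open>c\<close> to 0.\<close>

lemma tendsto_along_trailing_ones:
  assumes "filterlim s at_top at_top"
    and "(c \<longlongrightarrow> 0) at_top"
    and "\<And>k. k > 0 \<Longrightarrow> \<bar>a k - l\<bar> \<le> c (trailing_ones k)"
  shows "tendsto_along (\<Union>p\<in>{1..}. {k \<in> dyadic_block p. trailing_ones k \<ge> s p}) a l"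
    (is "tendsto_along ?E _ _")
  unfolding tendsto_along_def tendsto_iff
proof safe
  fix e :: real assume "e > 0"
  with assms(2) have "\<forall>\<^sub>F m in at_top. \<bar>c m\<bar> < e"
    by (auto simp: tendsto_iff)
  then obtain m where m: "\<And>j. j \<ge> m \<Longrightarrow> \<bar>c j\<bar> < e"
    by (auto simp: eventually_at_top_linorder)
  obtain P where P: "\<And>p. p \<ge> P \<Longrightarrow> s p \<ge> m"
    using assms(1) by (auto simp: filterlim_at_top eventually_at_top_linorder)
  have "dist (a k) l < e" if "k \<ge> 2 ^ P" "k \<in> ?E" for k
  proof -
    from that(2) obtain p where p: "k \<in> dyadic_block p" "s p \<le> trailing_ones k" by auto
    have "(2::nat) ^ P < 2 ^ Suc p"
      using that(1) p(1) unfolding dyadic_block_def by simp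
    then have "P \<le> p" by (simp del: power_Suc)
    with P p(2) have "m \<le> trailing_ones k" by (meson le_trans)
    moreover have "(0::nat) < 2 ^ P" by simp
    then have "k > 0" using that(1) by linarith
    ultimately show ?thesis
      using m[of "trailing_ones k"] assms(3)[of k] by (simp add: dist_real_def)
  qed
  then show "\<forall>\<^sub>F k in inf sequentially (principal ?E). dist (a k) l < e"
    unfolding eventually_inf_principal eventually_at_top_linorder by blast
qed

subsection \<open>Parity of iterated absolute differences\<close>

lemma abs_differences_binary:
  assumes "\<And>i. \<xi> i \<omega> \<in> {0, 1}"
  shows "abs_differences \<xi> k n \<omega> \<in> {0, 1}"
proof (induction k arbitrary: n)
  case (Suc k)
  from Suc[of n] Suc[of "Suc n"] show ?case by auto
qed (use assms in simp)

text \<open>Modulo 2 an absolute difference is a sum, so iterated differencing follows Pascal's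
  rule.\<close>

lemma even_abs_differences_iff:
  "even (abs_differences \<xi> k n \<omega>) \<longleftrightarrow> even (\<Sum>i\<le>k. int (k choose i) * \<xi> (n + i) \<omega>)"
proof (induction k arbitrary: n)
  case (Suc k)
  let ?B = "\<lambda>k n. \<Sum>i\<le>k. int (k choose i) * \<xi> (n + i) \<omega>"
  have "?B (Suc k) n = \<xi> n \<omega> + (\<Sum>i\<le>k. int (Suc k choose Suc i) * \<xi> (n + Suc i) \<omega>)"
    by (subst sum.atMost_Suc_shift) simp
  also have "\<dots> = (\<xi> n \<omega> + (\<Sum>i\<le>k. int (k choose Suc i) * \<xi> (n + Suc i) \<omega>)) + ?B k (Suc n)"
    by (simp add: algebra_simps sum.distrib)
  also have "\<xi> n \<omega> + (\<Sum>i\<le>k. int (k choose Suc i) * \<xi> (n + Suc i) \<omega>)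
      = (\<Sum>i\<le>Suc k. int (k choose i) * \<xi> (n + i) \<omega>)"
    by (subst sum.atMost_Suc_shift) simp
  \<comment> \<open>The top term drops out because \<open>k choose Suc k = 0\<close>.\<close>
  also have "\<dots> = ?B k n" by simp
  finally have *: "?B (Suc k) n = ?B k n + ?B k (Suc n)" .
  show ?case
    unfolding * using Suc[of n] Suc[of "Suc n"] by auto
qed simp

lemma even_sum_mult_iff:
  fixes c x :: "'i \<Rightarrow> int"
  assumes "finite A"
  shows "even (\<Sum>i\<in>A. c i * x i) \<longleftrightarrow> even (\<Sum>i\<in>{i\<in>A. odd (c i)}. x i)"
  using assms
proof (induction rule: finite_induct)
  case (insert a A)
  have "{i \<in> insert a A. odd (c i)} =
      (if odd (c a) then insert a {i \<in> A. odd (c i)} else {i \<in> A. odd (c i)})" by auto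
  with insert show ?case by auto
qed simp

text \<open>Intersecting with \<open>{..n + k}\<close> removes nothing, since binomial coefficients
  vanish beyond \<open>k\<close>; it puts the sum into the form handled by
  \<open>parity_prob\<close> at time \<open>n + k\<close>.\<close>

lemma even_abs_differences_iff_sum:
  "even (abs_differences \<xi> k n \<omega>) \<longleftrightarrow>
     even (\<Sum>j\<in>(+) n ` {i. odd (k choose i)} \<inter> {..n + k}. \<xi> j \<omega>)"
proof -
  have "(+) n ` {i. odd (k choose i)} \<inter> {..n + k} = (+) n ` {i \<in> {..k}. odd (int (k choose i))}"
    by auto
  then have "(\<Sum>j\<in>(+) n ` {i. odd (k choose i)} \<inter> {..n + k}. \<xi> j \<omega>)
      = (\<Sum>i\<in>{i \<in> {..k}. odd (int (k choose i))}. \<xi> (n + i) \<omega>)"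
    by (simp add: sum.reindex)
  then show ?thesis
    using even_sum_mult_iff[of "{..k}" "\<lambda>i. int (k choose i)" "\<lambda>i. \<xi> (n + i) \<omega>"]
      even_abs_differences_iff[of \<xi> k n \<omega>] by simp
qed

subsection \<open>Signed marginals of a binary Markov chain\<close>

locale positive_binary_chain = prob_space M for M :: "'a measure" +
  fixes \<xi> :: "nat \<Rightarrow> 'a \<Rightarrow> int" and \<pi> :: "int \<Rightarrow> int \<Rightarrow> real"
  assumes chain: "markov_chain M {0, 1} \<pi> \<xi>"
    and nonzero: "\<And>x y. x \<in> {0, 1} \<Longrightarrow> y \<in> {0, 1} \<Longrightarrow> \<pi> x y \<noteq> 0"
begin

section \<open>Transition law of the chain\<close>

lemma transition_pos: "x \<in> {0, 1} \<Longrightarrow> y \<in> {0, 1} \<Longrightarrow> \<pi> x y > 0"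
  using chain nonzero unfolding markov_chain_def stochastic_matrix_def
  by (metis less_eq_real_def)

lemma transition_sum: "x \<in> {0, 1} \<Longrightarrow> \<pi> x 0 + \<pi> x 1 = 1"
  using chain unfolding markov_chain_def stochastic_matrix_def
  by (auto dest!: infsumI)

lemma measurable_chain: "\<xi> i \<in> measurable M (count_space {0, 1})"
  using chain unfolding markov_chain_def by blast

lemma chain_values: "\<omega> \<in> space M \<Longrightarrow> \<xi> i \<omega> \<in> {0, 1}"
  using measurable_space[OF measurable_chain] by fastforce

lemma sets_chain_eq: "{\<omega> \<in> space M. \<xi> i \<omega> = x} \<in> sets M"
proof (cases "x \<in> {0, 1}")
  case True
  then have "\<xi> i -` {x} \<inter> space M \<in> sets M"
    by (intro measurable_sets[OF measurable_chain]) auto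
  moreover have "\<xi> i -` {x} \<inter> space M = {\<omega> \<in> space M. \<xi> i \<omega> = x}" by auto
  ultimately show ?thesis by simp
next
  case False
  then have "{\<omega> \<in> space M. \<xi> i \<omega> = x} = {}" using chain_values by blast
  then show ?thesis by (simp only: sets.empty_sets)
qed

lemma sets_chain_cylinder: "{\<omega> \<in> space M. \<forall>i\<le>N. \<xi> i \<omega> = h i} \<in> sets M"
  using sets.sets_Collect_finite_All[of "{..N}" M "\<lambda>i \<omega>. \<xi> i \<omega> = h i"] sets_chain_eq
  by simp

lemma markov_property:
  assumes "\<And>i. i \<le> N \<Longrightarrow> h i \<in> {0, 1}" "y \<in> {0, 1}"
    and "\<P>(\<omega> in M. \<forall>i\<le>N. \<xi> i \<omega> = h i) > 0"
  shows "\<P>(\<omega> in M. \<xi> (Suc N) \<omega> = y \<bar> \<forall>i\<le>N. \<xi> i \<omega> = h i)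
       = \<P>(\<omega> in M. \<xi> (Suc N) \<omega> = y \<bar> \<xi> N \<omega> = h N)"
  by (rule chain[unfolded markov_chain_def, THEN conjunct2, THEN conjunct2, THEN conjunct2,
        THEN conjunct2, THEN conjunct1, rule_format, OF assms(2) assms(1) assms(3)])

lemma transition_prob:
  assumes "x \<in> {0, 1}" "y \<in> {0, 1}" "\<P>(\<omega> in M. \<xi> N \<omega> = x) > 0"
  shows "\<P>(\<omega> in M. \<xi> (Suc N) \<omega> = y \<bar> \<xi> N \<omega> = x) = \<pi> x y"
  by (rule chain[unfolded markov_chain_def, THEN conjunct2, THEN conjunct2, THEN conjunct2,
        THEN conjunct2, THEN conjunct2, rule_format, OF assms])

text \<open>The Markov property in product form, free of conditioning. On null cylinders both sides
  vanish, so sums over all prefixes need no case distinction.\<close>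

lemma cylinder_transition:
  assumes "\<And>i. i \<le> N \<Longrightarrow> h i \<in> {0, 1}" "y \<in> {0, 1}"
  shows "\<P>(\<omega> in M. (\<forall>i\<le>N. \<xi> i \<omega> = h i) \<and> \<xi> (Suc N) \<omega> = y)
       = \<P>(\<omega> in M. \<forall>i\<le>N. \<xi> i \<omega> = h i) * \<pi> (h N) y"
proof (cases "\<P>(\<omega> in M. \<forall>i\<le>N. \<xi> i \<omega> = h i) > 0")
  case True
  have "\<P>(\<omega> in M. \<forall>i\<le>N. \<xi> i \<omega> = h i) \<le> \<P>(\<omega> in M. \<xi> N \<omega> = h N)"
    by (intro finite_measure_mono sets_chain_eq) auto
  with True have pos: "\<P>(\<omega> in M. \<xi> N \<omega> = h N) > 0" by linarith
  have "\<P>(\<omega> in M. \<xi> (Suc N) \<omega> = y \<bar> \<forall>i\<le>N. \<xi> i \<omega> = h i) = \<pi> (h N) y"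
    using markov_property[of N h y] transition_prob[of "h N" y N] assms True pos by simp
  then show ?thesis using True by (simp add: cond_prob_def field_simps conj_commute)
next
  case False
  then have "\<P>(\<omega> in M. \<forall>i\<le>N. \<xi> i \<omega> = h i) = 0"
    by (simp add: zero_less_measure_iff)
  moreover have "\<P>(\<omega> in M. (\<forall>i\<le>N. \<xi> i \<omega> = h i) \<and> \<xi> (Suc N) \<omega> = y)
      \<le> \<P>(\<omega> in M. \<forall>i\<le>N. \<xi> i \<omega> = h i)"
    by (intro finite_measure_mono sets_chain_cylinder) auto
  ultimately show ?thesis by (simp add: measure_le_0_iff)
qed

section \<open>Events determined by a finite prefix of the path\<close>

lemma prefix_event_eq_Union:
  "{\<omega> \<in> space M. Q (restrict (\<lambda>i. \<xi> i \<omega>) {..N}) \<and> R \<omega>} =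
     (\<Union>h\<in>{h \<in> {..N} \<rightarrow>\<^sub>E {0, 1}. Q h}. {\<omega> \<in> space M. (\<forall>i\<le>N. \<xi> i \<omega> = h i) \<and> R \<omega>})"
  (is "?L = ?U")
proof (rule set_eqI, rule iffI)
  fix \<omega> assume "\<omega> \<in> ?L"
  then have \<omega>: "\<omega> \<in> space M" "Q (restrict (\<lambda>i. \<xi> i \<omega>) {..N})" "R \<omega>" by simp_all
  have "restrict (\<lambda>i. \<xi> i \<omega>) {..N} \<in> {..N} \<rightarrow>\<^sub>E {0, 1}"
    using chain_values[OF \<omega>(1)] by (simp add: restrict_PiE_iff)
  with \<omega> show "\<omega> \<in> ?U"
    by (intro UN_I[of "restrict (\<lambda>i. \<xi> i \<omega>) {..N}"]) simp_all
next
  fix \<omega> assume "\<omega> \<in> ?U"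
  then obtain h where h: "h \<in> {..N} \<rightarrow>\<^sub>E {0, 1}" "Q h" "\<forall>i\<le>N. \<xi> i \<omega> = h i"
    and \<omega>: "\<omega> \<in> space M" "R \<omega>" by blast
  from h have "restrict (\<lambda>i. \<xi> i \<omega>) {..N} = h"
    by (intro extensionalityI[of _ "{..N}"]) (auto simp: PiE_def)
  with h \<omega> show "\<omega> \<in> ?L" by simp
qed

lemma finite_prefixes: "finite {h \<in> {..N::nat} \<rightarrow>\<^sub>E {0::int, 1}. Q h}"
  by (rule finite_subset[of _ "{..N} \<rightarrow>\<^sub>E {0, 1}"]) (auto intro: finite_PiE)

text \<open>Prefixes are extensional functions on \<open>{..N}\<close>, so different ones already
  differ at some time up to \<open>N\<close>. Their cylinders are therefore disjoint, and there are
  only finitely many.\<close>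

lemma prob_prefix_event:
  assumes "{\<omega> \<in> space M. R \<omega>} \<in> sets M"
  shows "\<P>(\<omega> in M. Q (restrict (\<lambda>i. \<xi> i \<omega>) {..N}) \<and> R \<omega>) =
     (\<Sum>h\<in>{h \<in> {..N} \<rightarrow>\<^sub>E {0, 1}. Q h}. \<P>(\<omega> in M. (\<forall>i\<le>N. \<xi> i \<omega> = h i) \<and> R \<omega>))"
  unfolding prefix_event_eq_Union[of Q N R]
proof (rule finite_measure_finite_Union[OF finite_prefixes])
  show "(\<lambda>h. {\<omega> \<in> space M. (\<forall>i\<le>N. \<xi> i \<omega> = h i) \<and> R \<omega>})
      ` {h \<in> {..N} \<rightarrow>\<^sub>E {0, 1}. Q h} \<subseteq> sets M"
    by (intro image_subsetI sets.sets_Collect_conj sets_chain_cylinder assms)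
  show "disjoint_family_on (\<lambda>h. {\<omega> \<in> space M. (\<forall>i\<le>N. \<xi> i \<omega> = h i) \<and> R \<omega>})
      {h \<in> {..N} \<rightarrow>\<^sub>E {0, 1}. Q h}"
  proof (unfold disjoint_family_on_def, intro ballI impI equals0I)
    fix h g \<omega>
    assume "h \<in> {h \<in> {..N} \<rightarrow>\<^sub>E {0, 1}. Q h}" "g \<in> {h \<in> {..N} \<rightarrow>\<^sub>E {0, 1}. Q h}" "h \<noteq> g"
      "\<omega> \<in> {\<omega> \<in> space M. (\<forall>i\<le>N. \<xi> i \<omega> = h i) \<and> R \<omega>} \<inter>
        {\<omega> \<in> space M. (\<forall>i\<le>N. \<xi> i \<omega> = g i) \<and> R \<omega>}"
    then have "h \<in> {..N} \<rightarrow>\<^sub>E {0::int, 1}" "g \<in> {..N} \<rightarrow>\<^sub>E {0::int, 1}" "h \<noteq> g"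
      "\<forall>i\<le>N. \<xi> i \<omega> = h i" "\<forall>i\<le>N. \<xi> i \<omega> = g i"
      by blast+
    then have "h = g" by (intro PiE_ext[of h "{..N}" "\<lambda>_. {0, 1}" g]) (assumption+, metis atMost_iff)
    with \<open>h \<noteq> g\<close> show False by simp
  qed
qed

lemma sets_prefix_event: "{\<omega> \<in> space M. Q (restrict (\<lambda>i. \<xi> i \<omega>) {..N})} \<in> sets M"
proof -
  have "{\<omega> \<in> space M. Q (restrict (\<lambda>i. \<xi> i \<omega>) {..N}) \<and> True} \<in> sets M"
    unfolding prefix_event_eq_Union[of Q N "\<lambda>_. True"]
    by (intro sets.finite_UN finite_prefixes) (simp add: sets_chain_cylinder)
  then show ?thesis by simp
qed

text \<open>All prefixes in question end in \<open>x\<close>, so \<open>cylinder_transition\<close>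
  yields the same factor for each of them and it can be pulled out of the sum.\<close>

lemma prefix_event_transition:
  assumes "x \<in> {0, 1}" "y \<in> {0, 1}"
  shows "\<P>(\<omega> in M. (Q (restrict (\<lambda>i. \<xi> i \<omega>) {..N}) \<and> \<xi> N \<omega> = x) \<and> \<xi> (Suc N) \<omega> = y)
       = \<P>(\<omega> in M. Q (restrict (\<lambda>i. \<xi> i \<omega>) {..N}) \<and> \<xi> N \<omega> = x) * \<pi> x y"
proof -
  define Q' where "Q' h \<longleftrightarrow> Q h \<and> h N = x" for h
  have Q': "Q (restrict (\<lambda>i. \<xi> i \<omega>) {..N}) \<and> \<xi> N \<omega> = x \<longleftrightarrow> Q' (restrict (\<lambda>i. \<xi> i \<omega>) {..N})"
    for \<omega> by (simp add: Q'_def)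
  let ?H = "{h \<in> {..N} \<rightarrow>\<^sub>E {0, 1}. Q' h}"
  have "\<P>(\<omega> in M. Q' (restrict (\<lambda>i. \<xi> i \<omega>) {..N}) \<and> \<xi> (Suc N) \<omega> = y)
      = (\<Sum>h\<in>?H. \<P>(\<omega> in M. (\<forall>i\<le>N. \<xi> i \<omega> = h i) \<and> \<xi> (Suc N) \<omega> = y))"
    by (rule prob_prefix_event[OF sets_chain_eq])
  also have "\<dots> = (\<Sum>h\<in>?H. \<P>(\<omega> in M. \<forall>i\<le>N. \<xi> i \<omega> = h i) * \<pi> x y)"
  proof (rule sum.cong[OF refl])
    fix h assume h: "h \<in> ?H"
    then have "\<And>i. i \<le> N \<Longrightarrow> h i \<in> {0, 1}" and "h N = x" by (auto simp: Q'_def)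
    with cylinder_transition[of N h y] assms
    show "\<P>(\<omega> in M. (\<forall>i\<le>N. \<xi> i \<omega> = h i) \<and> \<xi> (Suc N) \<omega> = y)
        = \<P>(\<omega> in M. \<forall>i\<le>N. \<xi> i \<omega> = h i) * \<pi> x y" by simp
  qed
  also have "\<dots> = \<P>(\<omega> in M. Q' (restrict (\<lambda>i. \<xi> i \<omega>) {..N})) * \<pi> x y"
    using prob_prefix_event[of "\<lambda>_. True" Q' N] by (simp add: sum_distrib_right)
  finally show ?thesis unfolding Q' .
qed

section \<open>Parity of partial sums and its contraction estimate\<close>

definition parity_prob :: "nat set \<Rightarrow> nat \<Rightarrow> bool \<Rightarrow> int \<Rightarrow> real" where
  "parity_prob S N b x = \<P>(\<omega> in M. (even (\<Sum>i\<in>S \<inter> {..N}. \<xi> i \<omega>) \<longleftrightarrow> b) \<and> \<xi> N \<omega> = x)"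

lemma sum_restrict_prefix:
  "(\<Sum>i\<in>S \<inter> {..N}. restrict (\<lambda>i. \<xi> i \<omega>) {..N} i) = (\<Sum>i\<in>S \<inter> {..N}. \<xi> i \<omega>)"
  by (intro sum.cong) auto

lemma sets_parity: "{\<omega> \<in> space M. even (\<Sum>i\<in>S \<inter> {..N}. \<xi> i \<omega>) \<longleftrightarrow> b} \<in> sets M"
  using sets_prefix_event[of "\<lambda>h. even (\<Sum>i\<in>S \<inter> {..N}. h i) \<longleftrightarrow> b" N]
  by (simp only: sum_restrict_prefix)

lemma prob_split_value:
  assumes "{\<omega> \<in> space M. R \<omega>} \<in> sets M"
  shows "\<P>(\<omega> in M. R \<omega>) = \<P>(\<omega> in M. R \<omega> \<and> \<xi> N \<omega> = 0) + \<P>(\<omega> in M. R \<omega> \<and> \<xi> N \<omega> = 1)"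
proof -
  have "{\<omega> \<in> space M. R \<omega>} = {\<omega> \<in> space M. R \<omega> \<and> \<xi> N \<omega> = 0} \<union> {\<omega> \<in> space M. R \<omega> \<and> \<xi> N \<omega> = 1}"
    using chain_values[of _ N] by auto
  then show ?thesis
    using assms
    by (simp only:) (intro finite_measure_Union sets.sets_Collect_conj sets_chain_eq, auto)
qed

text \<open>Recording the current state next to the parity makes a one-step recursion possible. The
  parity changes exactly when \<open>Suc N\<close> belongs to \<open>S\<close> and the new state is
  1, so in that case the opposite parity is required at time \<open>N\<close>.\<close>

lemma parity_prob_Suc:
  assumes "y \<in> {0, 1}"
  shows "parity_prob S (Suc N) b y =
      parity_prob S N (if Suc N \<in> S \<and> y = 1 then \<not> b else b) 0 * \<pi> 0 y
    + parity_prob S N (if Suc N \<in> S \<and> y = 1 then \<not> b else b) 1 * \<pi> 1 y"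
proof -
  let ?c = "if Suc N \<in> S \<and> y = 1 then \<not> b else b"
  let ?R = "\<lambda>\<omega>. even (\<Sum>i\<in>S \<inter> {..N}. \<xi> i \<omega>) \<longleftrightarrow> ?c"
  have trans: "\<P>(\<omega> in M. (?R \<omega> \<and> \<xi> N \<omega> = x) \<and> \<xi> (Suc N) \<omega> = y) = parity_prob S N ?c x * \<pi> x y"
    if "x \<in> {0, 1}" for x
    using prefix_event_transition[OF that assms, of "\<lambda>h. even (\<Sum>i\<in>S \<inter> {..N}. h i) \<longleftrightarrow> ?c" N]
    by (simp only: parity_prob_def sum_restrict_prefix)
  have "S \<inter> {..Suc N} = (if Suc N \<in> S then insert (Suc N) (S \<inter> {..N}) else S \<inter> {..N})"
    by (auto simp: le_Suc_eq)
  then have "(even (\<Sum>i\<in>S \<inter> {..Suc N}. \<xi> i \<omega>) \<longleftrightarrow> b) \<and> \<xi> (Suc N) \<omega> = y \<longleftrightarrow>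
      ?R \<omega> \<and> \<xi> (Suc N) \<omega> = y" for \<omega>
    using assms by auto
  then have "parity_prob S (Suc N) b y = \<P>(\<omega> in M. ?R \<omega> \<and> \<xi> (Suc N) \<omega> = y)"
    by (simp only: parity_prob_def)
  also have "\<dots> = \<P>(\<omega> in M. (?R \<omega> \<and> \<xi> (Suc N) \<omega> = y) \<and> \<xi> N \<omega> = 0)
      + \<P>(\<omega> in M. (?R \<omega> \<and> \<xi> (Suc N) \<omega> = y) \<and> \<xi> N \<omega> = 1)"
    by (intro prob_split_value sets.sets_Collect_conj sets_parity sets_chain_eq)
  also have "\<dots> = \<P>(\<omega> in M. (?R \<omega> \<and> \<xi> N \<omega> = 0) \<and> \<xi> (Suc N) \<omega> = y)
      + \<P>(\<omega> in M. (?R \<omega> \<and> \<xi> N \<omega> = 1) \<and> \<xi> (Suc N) \<omega> = y)"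
    by (simp only: conj_ac)
  also have "\<dots> = parity_prob S N ?c 0 * \<pi> 0 y + parity_prob S N ?c 1 * \<pi> 1 y"
    using trans[of 0] trans[of 1] by simp
  finally show ?thesis .
qed

text \<open>This is the expectation of (-1)^T on the event that the chain is in \<open>x\<close> at
  time \<open>N\<close>, where T is the sum of the chain over the indices of \<open>S\<close> up to
  \<open>N\<close>.\<close>

definition signed_marginal :: "nat set \<Rightarrow> nat \<Rightarrow> int \<Rightarrow> real" where
  "signed_marginal S N x = parity_prob S N True x - parity_prob S N False x"

text \<open>The l1 norm of the row vector of signed marginals. Multiplying the row vector by a
  matrix increases this norm at most by the maximal absolute row sum.\<close>

definition signed_mass :: "nat set \<Rightarrow> nat \<Rightarrow> real" where
  "signed_mass S N = \<bar>signed_marginal S N 0\<bar> + \<bar>signed_marginal S N 1\<bar>"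

lemma signed_marginal_Suc_0:
  "signed_marginal S (Suc N) 0 = signed_marginal S N 0 * \<pi> 0 0 + signed_marginal S N 1 * \<pi> 1 0"
  by (simp add: signed_marginal_def parity_prob_Suc algebra_simps)

text \<open>Only arrival in state 1 can change the sign, so the row vector is multiplied by P D if
  \<open>Suc N\<close> is in \<open>S\<close> and by P otherwise.\<close>

lemma signed_marginal_Suc_1:
  "signed_marginal S (Suc N) 1 = (if Suc N \<in> S then - 1 else 1) *
     (signed_marginal S N 0 * \<pi> 0 1 + signed_marginal S N 1 * \<pi> 1 1)"
  by (cases "Suc N \<in> S") (simp_all add: signed_marginal_def parity_prob_Suc algebra_simps)

text \<open>The sign of the second column disappears under absolute values; what remains are the
  rows of \<open>\<pi>\<close>, which are positive and sum to 1.\<close>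

lemma signed_mass_Suc_le: "signed_mass S (Suc N) \<le> signed_mass S N"
proof -
  let ?u = "signed_marginal S N 0" and ?v = "signed_marginal S N 1"
  have pos: "\<pi> 0 0 > 0" "\<pi> 0 1 > 0" "\<pi> 1 0 > 0" "\<pi> 1 1 > 0"
    by (auto intro: transition_pos)
  have "signed_mass S (Suc N) =
      \<bar>?u * \<pi> 0 0 + ?v * \<pi> 1 0\<bar> + \<bar>?u * \<pi> 0 1 + ?v * \<pi> 1 1\<bar>"
    by (auto simp: signed_mass_def signed_marginal_Suc_0 signed_marginal_Suc_1)
  also have "\<dots> \<le> (\<bar>?u\<bar> * \<pi> 0 0 + \<bar>?v\<bar> * \<pi> 1 0) + (\<bar>?u\<bar> * \<pi> 0 1 + \<bar>?v\<bar> * \<pi> 1 1)"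
    using pos by (intro add_mono order_trans[OF abs_triangle_ineq]) (simp_all add: abs_mult)
  also have "\<dots> = \<bar>?u\<bar> * (\<pi> 0 0 + \<pi> 0 1) + \<bar>?v\<bar> * (\<pi> 1 0 + \<pi> 1 1)"
    by (simp add: algebra_simps)
  also have "\<dots> = signed_mass S N" by (simp add: transition_sum signed_mass_def)
  finally show ?thesis .
qed

lemma signed_mass_antimono: "N \<le> N' \<Longrightarrow> signed_mass S N' \<le> signed_mass S N"
  by (rule lift_Suc_antimono_le[of "signed_mass S", OF signed_mass_Suc_le])

text \<open>The four joint probabilities of parity and state are nonnegative and sum to 1.\<close>

lemma signed_mass_le_1: "signed_mass S N \<le> 1"
proof -
  have nn: "parity_prob S N b x \<ge> 0" for b x by (simp add: parity_prob_def)
  have split: "\<P>(\<omega> in M. even (\<Sum>i\<in>S \<inter> {..N}. \<xi> i \<omega>) \<longleftrightarrow> b) = parity_prob S N b 0 + parity_prob S N b 1"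
    for b unfolding parity_prob_def by (rule prob_split_value[OF sets_parity])
  have "{\<omega> \<in> space M. even (\<Sum>i\<in>S \<inter> {..N}. \<xi> i \<omega>) \<longleftrightarrow> False} =
      space M - {\<omega> \<in> space M. even (\<Sum>i\<in>S \<inter> {..N}. \<xi> i \<omega>) \<longleftrightarrow> True}" by auto
  then have "\<P>(\<omega> in M. even (\<Sum>i\<in>S \<inter> {..N}. \<xi> i \<omega>) \<longleftrightarrow> False) =
      1 - \<P>(\<omega> in M. even (\<Sum>i\<in>S \<inter> {..N}. \<xi> i \<omega>) \<longleftrightarrow> True)"
    by (simp only: prob_compl[OF sets_parity])
  with split[of True] split[of False] nn[of True 0] nn[of True 1] nn[of False 0] nn[of False 1]
  show ?thesis unfolding signed_mass_def signed_marginal_def by linarith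
qed

text \<open>The maximal absolute row sum of the square of \<open>((\<pi> 0 0, - \<pi> 0 1), (\<pi> 1 0, - \<pi> 1 1))\<close>; the
  square is needed because this matrix itself has all absolute row sums equal to \<open>1\<close>.\<close>

definition contraction_factor :: real where
  "contraction_factor = max
     (\<bar>\<pi> 0 0 * \<pi> 0 0 - \<pi> 0 1 * \<pi> 1 0\<bar> + \<bar>\<pi> 0 1 * \<pi> 1 1 - \<pi> 0 0 * \<pi> 0 1\<bar>)
     (\<bar>\<pi> 1 0 * \<pi> 0 0 - \<pi> 1 1 * \<pi> 1 0\<bar> + \<bar>\<pi> 1 1 * \<pi> 1 1 - \<pi> 1 0 * \<pi> 0 1\<bar>)"

lemma contraction_factor_nonneg: "contraction_factor \<ge> 0"
  by (simp add: contraction_factor_def le_max_iff_disj)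

text \<open>Without cancellation each row sum would be 1. In the diagonal entry two positive
  products are subtracted, which makes the triangle inequality strict.\<close>

lemma contraction_factor_less_1: "contraction_factor < 1"
proof -
  have *: "\<bar>a * a - b * c\<bar> + \<bar>b * d - a * b\<bar> < 1"
    if "a > 0" "b > 0" "c > 0" "d > 0" "a + b = 1" "c + d = 1" for a b c d :: real
  proof -
    have "\<bar>a * a - b * c\<bar> < a * a + b * c" using that by (simp add: abs_less_iff)
    moreover have "\<bar>b * d - a * b\<bar> \<le> b * d + a * b" using that by (simp add: abs_le_iff)
    moreover have "(a * a + b * c) + (b * d + a * b) = a * (a + b) + b * (c + d)"
      by (simp add: algebra_simps)
    ultimately show ?thesis using that by simp
  qed
  have pos: "\<pi> 0 0 > 0" "\<pi> 0 1 > 0" "\<pi> 1 0 > 0" "\<pi> 1 1 > 0"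
    by (auto intro: transition_pos)
  have "\<pi> 0 0 + \<pi> 0 1 = 1" "\<pi> 1 0 + \<pi> 1 1 = 1" by (auto intro: transition_sum)
  \<comment> \<open>The second row is the first one with the two states interchanged.\<close>
  with pos *[of "\<pi> 0 0" "\<pi> 0 1" "\<pi> 1 0" "\<pi> 1 1"] *[of "\<pi> 1 1" "\<pi> 1 0" "\<pi> 0 1" "\<pi> 0 0"]
  show ?thesis unfolding contraction_factor_def by (simp add: algebra_simps)
qed

text \<open>Two consecutive indices in \<open>S\<close> multiply the row vector by (P D)^2. Its
  entries are the coefficients of \<open>?u\<close> and \<open>?v\<close>; collecting these by rows
  produces the row sums in \<open>contraction_factor\<close>.\<close>

lemma signed_mass_contract:
  assumes "Suc N \<in> S" "Suc (Suc N) \<in> S"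
  shows "signed_mass S (Suc (Suc N)) \<le> contraction_factor * signed_mass S N"
proof -
  let ?u = "signed_marginal S N 0" and ?v = "signed_marginal S N 1"
  let ?a = "\<pi> 0 0" and ?b = "\<pi> 0 1" and ?c = "\<pi> 1 0" and ?d = "\<pi> 1 1"
  have "signed_marginal S (Suc (Suc N)) 0 = ?u * (?a * ?a - ?b * ?c) + ?v * (?c * ?a - ?d * ?c)"
    using assms by (simp add: signed_marginal_Suc_0 signed_marginal_Suc_1 algebra_simps)
  then have 0: "\<bar>signed_marginal S (Suc (Suc N)) 0\<bar> \<le>
      \<bar>?u\<bar> * \<bar>?a * ?a - ?b * ?c\<bar> + \<bar>?v\<bar> * \<bar>?c * ?a - ?d * ?c\<bar>"
    by (metis abs_mult abs_triangle_ineq)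
  have "signed_marginal S (Suc (Suc N)) 1 = ?u * (?b * ?d - ?a * ?b) + ?v * (?d * ?d - ?c * ?b)"
    using assms by (simp add: signed_marginal_Suc_0 signed_marginal_Suc_1 algebra_simps)
  then have 1: "\<bar>signed_marginal S (Suc (Suc N)) 1\<bar> \<le>
      \<bar>?u\<bar> * \<bar>?b * ?d - ?a * ?b\<bar> + \<bar>?v\<bar> * \<bar>?d * ?d - ?c * ?b\<bar>"
    by (metis abs_mult abs_triangle_ineq)
  have "signed_mass S (Suc (Suc N)) \<le>
      \<bar>?u\<bar> * (\<bar>?a * ?a - ?b * ?c\<bar> + \<bar>?b * ?d - ?a * ?b\<bar>) +
      \<bar>?v\<bar> * (\<bar>?c * ?a - ?d * ?c\<bar> + \<bar>?d * ?d - ?c * ?b\<bar>)"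
    using 0 1 unfolding signed_mass_def by (simp add: distrib_left)
  also have "\<dots> \<le> \<bar>?u\<bar> * contraction_factor + \<bar>?v\<bar> * contraction_factor"
    unfolding contraction_factor_def by (intro add_mono mult_left_mono) auto
  also have "\<dots> = contraction_factor * signed_mass S N"
    by (simp add: signed_mass_def algebra_simps)
  finally show ?thesis .
qed

text \<open>The steps after time \<open>n\<close> are grouped in pairs, each contributing one
  factor. Starting from the bound 1 at time \<open>n\<close> keeps the estimate independent of
  \<open>n\<close>.\<close>

lemma signed_mass_run_le:
  assumes "\<And>i. i \<le> 2 * j \<Longrightarrow> n + i \<in> S"
  shows "signed_mass S (n + 2 * j) \<le> contraction_factor ^ j"
  using assms
proof (induction j)
  case 0
  then show ?case using signed_mass_le_1 by simp
next
  case (Suc j)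
  have "signed_mass S (n + 2 * Suc j) \<le> contraction_factor * signed_mass S (n + 2 * j)"
    using signed_mass_contract[of "n + 2 * j" S] Suc.prems[of "2 * j + 1"] Suc.prems[of "2 * j + 2"]
    by simp
  also have "\<dots> \<le> contraction_factor * contraction_factor ^ j"
    using Suc.prems by (intro mult_left_mono Suc.IH contraction_factor_nonneg) simp
  finally show ?case by simp
qed

subsection \<open>Marginals of iterated absolute differences\<close>

lemma abs_differences_values:
  "\<omega> \<in> space M \<Longrightarrow> abs_differences \<xi> k n \<omega> \<in> {0, 1}"
  by (rule abs_differences_binary) (rule chain_values)

lemma abs_differences_eq_events:
  defines "S \<equiv> \<lambda>n k. (+) n ` {i. odd (k choose i)}"
  shows "{\<omega> \<in> space M. abs_differences \<xi> k n \<omega> = 0} =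
      {\<omega> \<in> space M. even (\<Sum>i\<in>S n k \<inter> {..n + k}. \<xi> i \<omega>) \<longleftrightarrow> True}"
    and "{\<omega> \<in> space M. abs_differences \<xi> k n \<omega> = 1} =
      {\<omega> \<in> space M. even (\<Sum>i\<in>S n k \<inter> {..n + k}. \<xi> i \<omega>) \<longleftrightarrow> False}"
proof -
  have "abs_differences \<xi> k n \<omega> = (if even (\<Sum>i\<in>S n k \<inter> {..n + k}. \<xi> i \<omega>) then 0 else 1)"
    if "\<omega> \<in> space M" for \<omega>
    using abs_differences_values[OF that, of k n] even_abs_differences_iff_sum[of \<xi> k n \<omega>]
    unfolding S_def by (elim insertE emptyE) simp_all
  then show "{\<omega> \<in> space M. abs_differences \<xi> k n \<omega> = 0} =
      {\<omega> \<in> space M. even (\<Sum>i\<in>S n k \<inter> {..n + k}. \<xi> i \<omega>) \<longleftrightarrow> True}"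
    and "{\<omega> \<in> space M. abs_differences \<xi> k n \<omega> = 1} =
      {\<omega> \<in> space M. even (\<Sum>i\<in>S n k \<inter> {..n + k}. \<xi> i \<omega>) \<longleftrightarrow> False}"
    by (intro Collect_cong conj_cong refl; simp)+
qed

lemma sets_abs_differences:
  assumes "x \<in> {0, 1}"
  shows "{\<omega> \<in> space M. abs_differences \<xi> k n \<omega> = x} \<in> sets M"
  using assms
  by (elim insertE emptyE) (simp_all only: abs_differences_eq_events sets_parity)

lemma random_binary_sequence_abs_differences:
  "random_binary_sequence M (abs_differences \<xi> k)"
  unfolding random_binary_sequence_def
proof (intro conjI allI)
  fix n
  have "abs_differences \<xi> k n -` {x} \<inter> space M \<in> sets M" if "x \<in> {0, 1}" for x
  proof -
    have "abs_differences \<xi> k n -` {x} \<inter> space M = {\<omega> \<in> space M. abs_differences \<xi> k n \<omega> = x}"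
      by auto
    with sets_abs_differences[OF that] show ?thesis by simp
  qed
  then show "abs_differences \<xi> k n \<in> measurable M (count_space {0, 1})"
    using abs_differences_values by (subst measurable_count_space_eq2) auto
qed (rule prob_space_axioms)

text \<open>The difference of the two probabilities is the sum of the signed marginals at time
  \<open>n + k\<close>, hence at most the signed mass. As the probabilities sum to 1, each deviates
  from 1/2 by half of that difference.\<close>

lemma abs_differences_marginal:
  assumes "k > 0" "x \<in> {0, 1}"
  shows "\<bar>\<P>(\<omega> in M. abs_differences \<xi> k n \<omega> = x) - 1 / 2\<bar> \<le>
    contraction_factor ^ (trailing_ones k div 2)"
proof -
  define S where "S = (+) n ` {i. odd (k choose i)}"
  let ?p = "\<lambda>x. \<P>(\<omega> in M. abs_differences \<xi> k n \<omega> = x)"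
  let ?m = "trailing_ones k"
  have eqs: "?p 0 = parity_prob S (n + k) True 0 + parity_prob S (n + k) True 1"
      "?p 1 = parity_prob S (n + k) False 0 + parity_prob S (n + k) False 1"
    unfolding abs_differences_eq_events S_def parity_prob_def
    by (rule prob_split_value[OF sets_parity])+
  have "{\<omega> \<in> space M. abs_differences \<xi> k n \<omega> = 1} =
      space M - {\<omega> \<in> space M. abs_differences \<xi> k n \<omega> = 0}"
    using abs_differences_values[of _ k n] by auto
  moreover have "{\<omega> \<in> space M. abs_differences \<xi> k n \<omega> = 0} \<in> sets M"
    by (rule sets_abs_differences) simp
  ultimately have total: "?p 1 = 1 - ?p 0" by (simp add: prob_compl)
  \<comment> \<open>Of the \<open>2 ^ ?m\<close> consecutive odd coefficients only the first
    \<open>2 * (?m div 2) + 1\<close> are used; their contribution already vanishes as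
    \<open>?m\<close> grows.\<close>
  have odd: "odd (k choose i)" if "i \<le> 2 * (?m div 2)" for i
  proof (rule odd_binomial_of_trailing_ones[OF assms(1)])
    have "i \<le> ?m" using that by linarith
    also have "\<dots> < 2 ^ ?m" by simp
    finally show "i < 2 ^ ?m" .
  qed
  \<comment> \<open>An odd coefficient is nonzero, so the run ends by time \<open>n + k\<close> and
    the remaining steps cannot increase the mass.\<close>
  have "2 * (?m div 2) \<le> k"
    using odd[of "2 * (?m div 2)"] by (rule_tac ccontr) (simp add: binomial_eq_0)
  then have "signed_mass S (n + k) \<le> signed_mass S (n + 2 * (?m div 2))"
    by (intro signed_mass_antimono) simp
  also have "\<dots> \<le> contraction_factor ^ (?m div 2)"
    using odd by (intro signed_mass_run_le) (simp add: S_def)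
  finally have mass: "signed_mass S (n + k) \<le> contraction_factor ^ (?m div 2)" .
  have "\<bar>?p 0 - ?p 1\<bar> \<le> signed_mass S (n + k)"
    unfolding eqs signed_mass_def signed_marginal_def by linarith
  with mass total assms(2) show ?thesis by auto
qed

lemma contraction_factor_power_tendsto: "((\<lambda>m. contraction_factor ^ (m div 2)) \<longlongrightarrow> 0) at_top"
proof (rule filterlim_compose[of "\<lambda>m. contraction_factor ^ m"])
  show "(\<lambda>m. contraction_factor ^ m) \<longlonglongrightarrow> 0"
    using contraction_factor_nonneg contraction_factor_less_1 by (intro LIMSEQ_realpow_zero)
  show "filterlim (\<lambda>m::nat. m div 2) at_top at_top"
    unfolding filterlim_at_top
  proof
    fix Z :: nat
    show "\<forall>\<^sub>F m in at_top. Z \<le> m div 2"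
      using eventually_ge_at_top[of "2 * Z"] by eventually_elim linarith
  qed
qed

end

theorem theorem1:
  fixes M :: "'a measure" and \<xi> :: "nat \<Rightarrow> 'a \<Rightarrow> int" and \<pi> :: "int \<Rightarrow> int \<Rightarrow> real"
  assumes "markov_chain M {0, 1} \<pi> \<xi>"
    and "\<forall>x\<in>{0, 1}. \<forall>y\<in>{0, 1}. \<pi> x y \<noteq> 0"
    and "\<pi> 0 0 \<noteq> \<pi> 1 1"
    and "\<pi> 0 0 + \<pi> 1 1 \<noteq> 1"
  shows "(\<forall>(N :: 'b measure) \<eta>. equidistributed_binary_sequence N \<eta> \<longrightarrow>
            thick_limit_process N \<eta> M (abs_differences \<xi>)) \<and>
         (\<forall>x\<in>{0, 1}. \<forall>n. \<exists>s :: nat \<Rightarrow> nat.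
            (\<forall>p\<ge>1. s p \<le> p) \<and>
            filterlim s at_top at_top \<and>
            (\<Sum>\<^sub>\<infinity>p\<in>{1..}. ennreal (real (s p) / 2 ^ s p)) = \<infinity> \<and>
            (let E = (\<Union>p\<in>{1..}. {k \<in> dyadic_block p. trailing_ones k \<ge> s p}) in
               thick_set E \<and>
               tendsto_along E (\<lambda>k. \<P>(\<omega> in M. abs_differences \<xi> k n \<omega> = x)) (1 / 2)))"
proof -
  interpret prob_space M using assms(1) unfolding markov_chain_def by blast
  interpret positive_binary_chain M \<xi> \<pi>
    using assms(1,2) by unfold_locales auto
  \<comment> \<open>One set serves all \<open>x\<close> and \<open>n\<close>, because the bound on
    the marginals depends on \<open>k\<close> alone.\<close>
  define E where "E = (\<Union>p\<in>{1..}. {k \<in> dyadic_block p. trailing_ones k \<ge> floor_log p})"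
  have diverge: "(\<Sum>\<^sub>\<infinity>p\<in>{1..}. ennreal (real (floor_log p) / 2 ^ floor_log p)) = \<infinity>"
    by (intro infsum_ge_harmonic_eq_top ennreal_leI inverse_le_floor_log_quotient)
  have "(\<Sum>\<^sub>\<infinity>p\<in>{1..}. discrete_capacity (E \<inter> dyadic_block p) / 2 ^ p) = \<infinity>"
  proof (rule infsum_ge_harmonic_eq_top)
    fix p :: nat assume p: "p \<ge> 2"
    have "ennreal (1 / real p) \<le> ennreal (real (floor_log p) / 2 ^ floor_log p)"
      using p by (intro ennreal_leI inverse_le_floor_log_quotient)
    also have "\<dots> \<le> discrete_capacity (E \<inter> dyadic_block p) / 2 ^ p"
      unfolding E_def using p
      by (intro discrete_capacity_dyadic_block_ge floor_log_le_self UN_upper) simp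
    finally show "ennreal (1 / real p) \<le> discrete_capacity (E \<inter> dyadic_block p) / 2 ^ p" .
  qed
  then have thick: "thick_set E" by (simp add: thin_set_def)
  have lim: "tendsto_along E (\<lambda>k. \<P>(\<omega> in M. abs_differences \<xi> k n \<omega> = x)) (1 / 2)"
    if "x \<in> {0, 1}" for x n
    unfolding E_def
    by (rule tendsto_along_trailing_ones[OF filterlim_floor_log contraction_factor_power_tendsto])
      (rule abs_differences_marginal[OF _ that])
  have "thick_limit_process N \<eta> M (abs_differences \<xi>)"
    if "equidistributed_binary_sequence N \<eta>" for N :: "'b measure" and \<eta>
  proof -
    have "thick_limit_point (\<lambda>k. \<P>(\<omega> in M. abs_differences \<xi> k n \<omega> = x)) \<P>(\<omega> in N. \<eta> n \<omega> = x)"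
      if "x \<in> {0, 1}" for x n
    proof -
      have "\<P>(\<omega> in N. \<eta> n \<omega> = x) = 1 / 2"
        using \<open>equidistributed_binary_sequence N \<eta>\<close> that
        unfolding equidistributed_binary_sequence_def by auto
      with thick lim[OF that, of n] show ?thesis unfolding thick_limit_point_def by (simp only:) blast
    qed
    with that show ?thesis
      unfolding thick_limit_process_def equidistributed_binary_sequence_def
      by (auto intro: random_binary_sequence_abs_differences)
  qed
  moreover have "\<exists>s :: nat \<Rightarrow> nat.
      (\<forall>p\<ge>1. s p \<le> p) \<and> filterlim s at_top at_top \<and>
      (\<Sum>\<^sub>\<infinity>p\<in>{1..}. ennreal (real (s p) / 2 ^ s p)) = \<infinity> \<and>
      (let E = (\<Union>p\<in>{1..}. {k \<in> dyadic_block p. trailing_ones k \<ge> s p}) in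
         thick_set E \<and> tendsto_along E (\<lambda>k. \<P>(\<omega> in M. abs_differences \<xi> k n \<omega> = x)) (1 / 2))"
    if "x \<in> {0, 1}" for x n
    using floor_log_le_self filterlim_floor_log diverge thick lim[OF that, of n]
    by (intro exI[of _ floor_log]) (simp add: E_def)
  ultimately show ?thesis by blast
qed

end
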